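(* Let $\alpha\in(1,4.34]$ and $f:\mathbb{R}\to\mathbb{R}$, $f(w)=w^2+\alpha\sin^2(w)$. Then $f$ is twice differentiable, has $L$-Lipschitz gradient with $L=2+2\alpha$ and $L_H$-Lipschitz Hessian with $L_H=4\alpha$, and its global minimizer is $w_*=0$. Furthermore, $f$ is non-convex but satisfies $\mu$-PL at any $w$ with $$\mu=\frac{\left(2+\frac{\sin(2w)}{w}\alpha\right)^2}{2+2\alpha}\ge\frac{(2-0.46\alpha)^2}{2+2\alpha},$$ and the average Hessian between $w$ and $w_*$ is $H_f(w)=2+\frac{\sin(2w)}{w}\alpha>0$, where $\frac{\sin(2w)}{w}\ge-0.46$. Therefore $f$ satisfies $\lambda_*$-average out with respect to $w_*$ at every $w$, with $\lambda_*=2-0.46\alpha$.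
   Context: At $w=0$ the expression $\frac{\sin(2w)}{w}$ is understood as its limit $2$. $f$ is $\mu$-PL (Polyak-Łojasiewicz) at $w$ if $\|\nabla f(w)\|^2\ge2\mu(f(w)-\min f)$. The average Hessian at $w$ (towards $w_*$) is $H_f(w):=\int_0^1\nabla^2f(\theta w+(1-\theta)w_* )\,d\theta$; $f$ satisfies $\lambda_*$-average out with respect to $w_*$ at $w$ if $\lambda_{\min}(H_f(w))\ge\lambda_*>0$. *)

theory Defs
  imports "HOL-Analysis.Analysis"
begin

definition gradient :: "('a::euclidean_space \<Rightarrow> real) \<Rightarrow> 'a \<Rightarrow> 'a" where
  "gradient f x = (THE D. GDERIV f x :> D)"

definition twice_differentiable :: "('a::euclidean_space \<Rightarrow> real) \<Rightarrow> bool" where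
  "twice_differentiable f \<longleftrightarrow>
     (\<forall>x. f differentiable (at x)) \<and> (\<forall>x. gradient f differentiable (at x))"

text \<open>The Hessian is the Frechet derivative of the gradient, as a bounded linear operator; the
  norm and distance on the operator type are those of the operator norm. It is only meaningful
  where the gradient is differentiable.\<close>

definition hessian :: "('a::euclidean_space \<Rightarrow> real) \<Rightarrow> 'a \<Rightarrow> 'a \<Rightarrow>\<^sub>L 'a" where
  "hessian f x = Blinfun (frechet_derivative (gradient f) (at x))"

definition avg_hessian :: "('a::euclidean_space \<Rightarrow> real) \<Rightarrow> 'a \<Rightarrow> 'a \<Rightarrow> 'a \<Rightarrow>\<^sub>L 'a" where
  "avg_hessian f w_star w =
     integral {0..1} (\<lambda>\<theta>::real. hessian f (\<theta> *\<^sub>R w + (1 - \<theta>) *\<^sub>R w_star))"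

definition lambda_min :: "('a::euclidean_space \<Rightarrow>\<^sub>L 'a) \<Rightarrow> real" where
  "lambda_min A = (LEAST l. \<exists>v. v \<noteq> 0 \<and> blinfun_apply A v = l *\<^sub>R v)"

definition average_out :: "real \<Rightarrow> ('a::euclidean_space \<Rightarrow> real) \<Rightarrow> 'a \<Rightarrow> 'a \<Rightarrow> bool" where
  "average_out l f w_star w \<longleftrightarrow> lambda_min (avg_hessian f w_star w) \<ge> l \<and> l > 0"

definition PL_at :: "real \<Rightarrow> ('a::euclidean_space \<Rightarrow> real) \<Rightarrow> 'a \<Rightarrow> bool" where
  "PL_at \<mu> f w \<longleftrightarrow> (norm (gradient f w))\<^sup>2 \<ge> 2 * \<mu> * (f w - (LEAST m. m \<in> range f))"

definition sin2_quot :: "real \<Rightarrow> real" where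
  "sin2_quot w = (if w = 0 then 2 else sin (2 * w) / w)"

end

theory Submission
  imports Defs
begin

text \<open>Everything rests on three observations about \<open>f w = w\<^sup>2 + \<alpha> * (sin w)\<^sup>2\<close>.

  On the real line the gradient is the ordinary derivative \<open>2 * w + \<alpha> * sin (2 * w)\<close>, and the Hessian
  is multiplication by \<open>2 + 2 * \<alpha> * cos (2 * w)\<close>
  (\<open>gradient_eq_derivative\<close>, \<open>hessian_eq_second_derivative\<close>). Both Lipschitz constants are then bounds
  on the next derivative. Averaging the Hessian over the segment from \<open>0\<close> to \<open>w\<close> gives, by the
  fundamental theorem of calculus, the difference quotient of the gradient, which is
  \<open>2 + sin2_quot w * \<alpha>\<close>. Hence the gradient at \<open>w\<close> is the average Hessian applied to \<open>w\<close>, and the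
  Polyak--Lojasiewicz inequality with the stated constant only says that
  \<open>f w \<le> (1 + \<alpha>) * w\<^sup>2\<close>, i.e. that \<open>(sin w)\<^sup>2 \<le> w\<^sup>2\<close>.

  The constant \<open>0.46\<close> comes from the estimate \<open>sin x \<ge> - 0.23 * x\<close> for \<open>x > 0\<close> (\<open>sin_ge_linear\<close>). Only the
  interval between \<open>pi\<close> and \<open>1 / 0.23\<close> needs an argument, and a comparison with a tangent line
  of the sine settles it. Since \<open>0.46 * 4.34 < 2\<close>, the average Hessian is uniformly positive.

  Convexity fails at \<open>pi / 2\<close>, where the second derivative is \<open>2 - 2 * \<alpha> < 0\<close>: the second
  difference of \<open>f\<close> with step \<open>t\<close> is \<open>2 * t\<^sup>2 - 2 * \<alpha> * (sin t)\<^sup>2\<close>, which is negative for small \<open>t\<close>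
  because \<open>sin t / t\<close> tends to \<open>1\<close>.\<close>

section \<open>Gradients and Hessians on the real line\<close>

lemma gradient_eq_derivative:
  assumes "(f has_real_derivative D) (at x)"
  shows "gradient f x = D"
  unfolding gradient_def gderiv_deriv using assms by (blast intro: DERIV_unique)

lemma hessian_eq_second_derivative:
  assumes "\<And>x. (f has_real_derivative f' x) (at x)"
    and "(f' has_real_derivative c) (at x)"
  shows "hessian f x = c *\<^sub>R id_blinfun"
proof -
  have "gradient f = f'"
    using assms(1) by (intro ext gradient_eq_derivative)
  moreover have "frechet_derivative f' (at x) = (*) c"
    using assms(2) unfolding has_field_derivative_def
    by (metis frechet_derivative_at)
  ultimately show ?thesis
    unfolding hessian_def
    by (intro blinfun_eqI)
       (simp add: bounded_linear_Blinfun_apply bounded_linear_mult_right blinfun.scaleR_left)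
qed

lemma lipschitz_on_real_derivative_bound:
  fixes g :: "real \<Rightarrow> real"
  assumes "\<And>x. (g has_real_derivative g' x) (at x)" and bound: "\<And>x. \<bar>g' x\<bar> \<le> C"
  shows "C-lipschitz_on UNIV g"
proof (rule bounded_derivative_imp_lipschitz)
  fix x
  show "(g has_derivative (*) (g' x)) (at x within UNIV)"
    using assms(1)[of x] by (simp add: has_field_derivative_def)
  show "onorm ((*) (g' x)) \<le> C"
    by (rule onorm_bound) (use bound[of x] in \<open>auto simp: abs_mult intro: mult_right_mono\<close>)
qed (use bound[of 0] in auto)

lemma lambda_min_scaleR_id:
  "lambda_min (c *\<^sub>R id_blinfun :: 'a::euclidean_space \<Rightarrow>\<^sub>L 'a) = c"
proof -
  obtain b :: 'a where "b \<in> Basis"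
    using nonempty_Basis by blast
  then have "b \<noteq> 0"
    by (rule nonzero_Basis)
  then have "(\<exists>v::'a. v \<noteq> 0 \<and> c *\<^sub>R v = l *\<^sub>R v) \<longleftrightarrow> l = c" for l
    by auto
  then show ?thesis
    by (simp add: lambda_min_def blinfun.scaleR_left Least_equality)
qed

section \<open>The lower bound on the sine quotient\<close>

text \<open>The graph of the sine on \<open>{pi..1/0.23}\<close>, translated to \<open>y = x - pi\<close> and negated, has to stay below the line
  \<open>0.23 * (pi + y)\<close>. The tangent at \<open>pi / 3\<close>, of slope \<open>1 / 2\<close>, does so with room to
  spare for \<open>y \<ge> pi / 3\<close>; below \<open>pi / 3\<close>, \<open>sin y \<le> y\<close> or monotonicity of the sine suffices.\<close>

lemma sin_ge_linear:
  fixes x :: real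
  assumes "0 < x"
  shows "- 0.23 * x \<le> sin x"
proof -
  \<comment> \<open>Beyond 4.35, slightly more than \<open>1 / 0.23\<close>, the line is below \<open>- 1\<close>.\<close>
  consider "x \<le> pi" | "pi < x" "x < 4.35" | "4.35 \<le> x"
    by linarith
  then show ?thesis
  proof cases
    case 1
    then have "0 \<le> sin x"
      using assms by (simp add: sin_ge_zero)
    then show ?thesis
      using assms by simp
  next
    case 2
    define y where "y = x - pi"
    have y: "0 < y" "y < 1.21"
      using 2 pi_approx by (auto simp: y_def)
    have x: "x = pi + y"
      by (simp add: y_def)
    have sqrt3: "sqrt 3 \<le> 1.7322"
      by (rule real_le_lsqrt) (auto simp: power2_eq_square)
    have "sin y \<le> 0.23 * (pi + y)"
    proof -
      consider "y \<le> 0.93" | "0.93 < y" "y \<le> pi / 3" | "pi / 3 < y"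
        by linarith
      then show ?thesis
      proof cases
        case 1
        then show ?thesis
          using sin_x_le_x[of y] y pi_approx by simp
      next
        case 2
        then have "sin y \<le> sin (pi / 3)"
          using y pi_gt3 by (intro sin_monotone_2pi_le) auto
        then show ?thesis
          using 2 sqrt3 pi_approx by (simp add: sin_60)
      next
        case 3
        define t where "t = y - pi / 3"
        have "sin y = sin (pi / 3 + t)"
          by (simp add: t_def)
        also have "\<dots> = sqrt 3 / 2 * cos t + sin t / 2"
          by (simp add: sin_add sin_60 cos_60)
        also have "\<dots> \<le> sqrt 3 / 2 + t / 2"
          using 3 by (intro add_mono mult_left_le divide_right_mono sin_x_le_x) (auto simp: t_def)
        also have "\<dots> \<le> 0.23 * (pi + y)"
          using sqrt3 pi_approx y by (simp add: t_def diff_divide_distrib)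
        finally show ?thesis .
      qed
    qed
    then show ?thesis
      by (simp add: x sin_add)
  next
    case 3
    then have "- 0.23 * x \<le> - 1"
      by simp
    also have "\<dots> \<le> sin x"
      by (rule sin_ge_minus_one)
    finally show ?thesis .
  qed
qed

lemma sin2_quot_ge: "- 0.46 \<le> sin2_quot w"
proof -
  have pos: "- 0.46 \<le> sin (2 * v) / v" if "0 < v" for v :: real
    using sin_ge_linear[of "2 * v"] that by (simp add: field_simps)
  consider "w = 0" | "0 < w" | "w < 0"
    by linarith
  then show ?thesis
  proof cases
    case 3
    then show ?thesis
      using pos[of "- w"] by (simp add: sin2_quot_def)
  qed (use pos in \<open>auto simp: sin2_quot_def\<close>)
qed

section \<open>Quadratics with a squared sine added\<close>

lemma derivative_square_plus_sin_square:
  assumes "\<And>w. f w = w\<^sup>2 + \<alpha> * (sin w)\<^sup>2"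
  shows "(f has_real_derivative 2 * w + \<alpha> * sin (2 * w)) (at w)"
proof -
  have "f = (\<lambda>w. w\<^sup>2 + \<alpha> * (sin w)\<^sup>2)"
    using assms by auto
  then show ?thesis
    by (auto intro!: derivative_eq_intros simp: sin_double)
qed

lemma derivative_linear_plus_sin_double:
  "((\<lambda>w. 2 * w + \<alpha> * sin (2 * w)) has_real_derivative 2 + 2 * \<alpha> * cos (2 * w)) (at w)"
  for \<alpha> :: real
  by (auto intro!: derivative_eq_intros)

lemma derivative_const_plus_cos_double:
  "((\<lambda>w. 2 + 2 * \<alpha> * cos (2 * w)) has_real_derivative - 4 * \<alpha> * sin (2 * w)) (at w)"
  for \<alpha> :: real
  by (auto intro!: derivative_eq_intros)

lemma hessian_square_plus_sin_square:
  assumes "\<And>w. f w = w\<^sup>2 + \<alpha> * (sin w)\<^sup>2"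
  shows "hessian f w = (2 + 2 * \<alpha> * cos (2 * w)) *\<^sub>R id_blinfun"
  using derivative_square_plus_sin_square[OF assms] derivative_linear_plus_sin_double
  by (rule hessian_eq_second_derivative)

text \<open>The antiderivative of \<open>\<theta> \<mapsto> 2 + 2 * \<alpha> * cos (2 * (\<theta> * w))\<close> divides by \<open>w\<close>, so \<open>w = 0\<close>, where the
  integrand is constant, is treated apart.\<close>

lemma avg_hessian_square_plus_sin_square:
  assumes "\<And>w. f w = w\<^sup>2 + \<alpha> * (sin w)\<^sup>2"
  shows "avg_hessian f 0 w = (2 + sin2_quot w * \<alpha>) *\<^sub>R id_blinfun"
proof -
  have "((\<lambda>\<theta>. 2 + 2 * \<alpha> * cos (2 * (\<theta> * w))) has_integral 2 + sin2_quot w * \<alpha>) {0..1}"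
  proof (cases "w = 0")
    case True
    then show ?thesis
      using has_integral_const_real[of "2 + 2 * \<alpha>" 0 1] by (simp add: sin2_quot_def mult.commute)
  next
    case False
    define F where "F = (\<lambda>\<theta>. 2 * \<theta> + \<alpha> * sin (2 * (\<theta> * w)) / w)"
    have "((\<lambda>\<theta>. 2 + 2 * \<alpha> * cos (2 * (\<theta> * w))) has_integral F 1 - F 0) {0..1}"
    proof (rule fundamental_theorem_of_calculus)
      show "(F has_vector_derivative 2 + 2 * \<alpha> * cos (2 * (\<theta> * w))) (at \<theta> within {0..1})" for \<theta>
        unfolding F_def has_real_derivative_iff_has_vector_derivative[symmetric]
        using False by (auto intro!: derivative_eq_intros)
    qed simp
    then show ?thesis
      using False by (simp add: F_def sin2_quot_def mult.commute)
  qed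
  from has_integral_scaleR_left[OF this]
  show ?thesis
    unfolding avg_hessian_def hessian_square_plus_sin_square[OF assms]
    by (intro integral_unique) simp
qed

lemma not_convex_on_square_plus_sin_square:
  assumes "1 < \<alpha>" and f: "\<And>w. f w = w\<^sup>2 + \<alpha> * (sin w)\<^sup>2"
  shows "\<not> convex_on UNIV f"
proof
  assume convex: "convex_on UNIV f"
  have "((\<lambda>t. sin t / t) \<longlongrightarrow> 1) (at (0::real))"
    using DERIV_sin[of "0::real"] by (simp add: DERIV_def)
  then have "((\<lambda>t. (sin t / t)\<^sup>2) \<longlongrightarrow> 1\<^sup>2) (at (0::real))"
    by (rule tendsto_power)
  then have "\<forall>\<^sub>F t in at (0::real). 1 / \<alpha> < (sin t / t)\<^sup>2"
    using assms(1) by (intro order_tendstoD(1)) auto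
  then have "\<forall>\<^sub>F t in at (0::real). 1 / \<alpha> < (sin t / t)\<^sup>2 \<and> t \<noteq> 0"
    by (intro eventually_conj) (auto simp: eventually_at_filter)
  then obtain t :: real where t: "1 / \<alpha> < (sin t / t)\<^sup>2" "t \<noteq> 0"
    using eventually_happens[of _ "at (0::real)"] by auto
  then have less: "t\<^sup>2 < \<alpha> * (sin t)\<^sup>2"
    using assms(1) by (simp add: field_simps)
  have "f ((1 - 1/2) *\<^sub>R (pi / 2 - t) + (1/2) *\<^sub>R (pi / 2 + t))
      \<le> (1 - 1/2) * f (pi / 2 - t) + (1/2) * f (pi / 2 + t)"
    by (rule convex_onD[OF convex]) auto
  moreover have "(1 - 1/2) *\<^sub>R (pi / 2 - t) + (1/2) *\<^sub>R (pi / 2 + t) = pi / 2"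
    by (simp add: field_simps)
  ultimately have "f (pi / 2) \<le> (1 - 1/2) * f (pi / 2 - t) + (1/2) * f (pi / 2 + t)"
    by (simp only:)
  moreover have "f (pi / 2 - t) = (pi / 2 - t)\<^sup>2 + \<alpha> * (cos t)\<^sup>2"
    "f (pi / 2 + t) = (pi / 2 + t)\<^sup>2 + \<alpha> * (cos t)\<^sup>2" "f (pi / 2) = (pi / 2)\<^sup>2 + \<alpha>"
    by (simp_all add: f sin_diff sin_add)
  ultimately have "\<alpha> \<le> t\<^sup>2 + \<alpha> * (cos t)\<^sup>2"
    by (simp add: power2_sum power2_diff add_divide_distrib diff_divide_distrib)
  then show False
    using less by (simp add: cos_squared_eq right_diff_distrib)
qed

text \<open>With \<open>q\<close> the sine quotient, the gradient is \<open>(2 + q * \<alpha>) * w\<close> and the minimum of \<open>f\<close> is \<open>0\<close>, so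
  the factor \<open>(2 + q * \<alpha>)\<^sup>2\<close> cancels and \<open>f w \<le> (1 + \<alpha>) * w\<^sup>2\<close> remains.\<close>

lemma PL_at_square_plus_sin_square:
  assumes "0 \<le> \<alpha>" and f: "\<And>w. f w = w\<^sup>2 + \<alpha> * (sin w)\<^sup>2"
  shows "PL_at ((2 + sin2_quot w * \<alpha>)\<^sup>2 / (2 + 2 * \<alpha>)) f w"
proof -
  define c where "c = 2 + sin2_quot w * \<alpha>"
  have grad: "gradient f w = c * w"
    using gradient_eq_derivative[OF derivative_square_plus_sin_square[OF f], of w]
    by (auto simp: c_def sin2_quot_def field_simps)
  have least: "(LEAST m. m \<in> range f) = 0"
    using assms by (intro Least_equality) (auto simp: f intro: image_eqI[where x = 0])
  have "(sin w)\<^sup>2 \<le> w\<^sup>2"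
    using abs_sin_x_le_abs_x[of w] by (simp add: abs_le_square_iff)
  then have "f w \<le> (1 + \<alpha>) * w\<^sup>2"
    using mult_left_mono[of "(sin w)\<^sup>2" "w\<^sup>2" \<alpha>] assms(1) by (simp add: f algebra_simps)
  then have "c\<^sup>2 / (1 + \<alpha>) * f w \<le> c\<^sup>2 / (1 + \<alpha>) * ((1 + \<alpha>) * w\<^sup>2)"
    using assms(1) by (intro mult_left_mono) auto
  moreover have "2 * (c\<^sup>2 / (2 + 2 * \<alpha>)) = c\<^sup>2 / (1 + \<alpha>)"
    using assms(1) by (simp add: field_simps)
  ultimately show ?thesis
    unfolding PL_at_def least grad c_def[symmetric]
    using assms(1) by (simp add: power_mult_distrib)
qed

theorem lemma4:
  fixes \<alpha> :: real and f :: "real \<Rightarrow> real"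
  assumes "1 < \<alpha>" and "\<alpha> \<le> 4.34"
    and "\<And>w. f w = w\<^sup>2 + \<alpha> * (sin w)\<^sup>2"
  shows "twice_differentiable f
    \<and> (2 + 2 * \<alpha>)-lipschitz_on UNIV (gradient f)
    \<and> (4 * \<alpha>)-lipschitz_on UNIV (hessian f)
    \<and> (\<forall>w. is_arg_min f (\<lambda>_. True) w \<longleftrightarrow> w = 0)
    \<and> \<not> convex_on UNIV f
    \<and> (\<forall>w. PL_at ((2 + sin2_quot w * \<alpha>)\<^sup>2 / (2 + 2 * \<alpha>)) f w
         \<and> (2 + sin2_quot w * \<alpha>)\<^sup>2 / (2 + 2 * \<alpha>) \<ge> (2 - 0.46 * \<alpha>)\<^sup>2 / (2 + 2 * \<alpha>))
    \<and> (\<forall>w. avg_hessian f 0 w = (2 + sin2_quot w * \<alpha>) *\<^sub>R id_blinfun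
         \<and> 2 + sin2_quot w * \<alpha> > 0
         \<and> sin2_quot w \<ge> -0.46)
    \<and> (\<forall>w. average_out (2 - 0.46 * \<alpha>) f 0 w)"
proof (intro conjI allI)
  note f = assms(3)
  note f' = derivative_square_plus_sin_square[OF f]
  have grad: "gradient f = (\<lambda>w. 2 * w + \<alpha> * sin (2 * w))"
    using f' by (intro ext gradient_eq_derivative)
  have lambda_pos: "0 < 2 - 0.46 * \<alpha>"
    using assms(2) by simp
  have avg_ge: "2 - 0.46 * \<alpha> \<le> 2 + sin2_quot w * \<alpha>" for w
    using mult_right_mono[OF sin2_quot_ge[of w], of \<alpha>] assms(1) by simp
  have scaled: "\<bar>\<beta> * s\<bar> \<le> \<beta>" if "0 \<le> \<beta>" "\<bar>s\<bar> \<le> 1" for \<beta> s :: real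
    using that by (simp add: abs_mult mult_left_le)

  show "twice_differentiable f"
    unfolding twice_differentiable_def grad
    using f' derivative_linear_plus_sin_double real_differentiable_def by blast
  show "(2 + 2 * \<alpha>)-lipschitz_on UNIV (gradient f)"
    unfolding grad
  proof (rule lipschitz_on_real_derivative_bound[OF derivative_linear_plus_sin_double])
    show "\<bar>2 + 2 * \<alpha> * cos (2 * w)\<bar> \<le> 2 + 2 * \<alpha>" for w
      using scaled[of "2 * \<alpha>" "cos (2 * w)"] assms(1) by (simp add: abs_le_iff)
  qed
  show "(4 * \<alpha>)-lipschitz_on UNIV (hessian f)"
  proof -
    have "(4 * \<alpha>)-lipschitz_on UNIV (\<lambda>w. 2 + 2 * \<alpha> * cos (2 * w))"
    proof (rule lipschitz_on_real_derivative_bound[OF derivative_const_plus_cos_double])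
      show "\<bar>- 4 * \<alpha> * sin (2 * w)\<bar> \<le> 4 * \<alpha>" for w
        using scaled[of "4 * \<alpha>" "sin (2 * w)"] assms(1) by (simp add: abs_mult)
    qed
    \<comment> \<open>Multiples of the identity are at the distance of their factors, as the identity has norm 1.\<close>
    then show ?thesis
      unfolding lipschitz_on_def hessian_square_plus_sin_square[OF f] dist_norm
      by (simp flip: scaleR_left_diff_distrib)
  qed
  show "is_arg_min f (\<lambda>_. True) w \<longleftrightarrow> w = 0" for w
  proof -
    have pos: "0 < f v" if "v \<noteq> 0" for v
      using assms(1) that by (simp add: f add_pos_nonneg)
    have zero: "f 0 = 0"
      by (simp add: f)
    have "\<not> f v < 0" for v
      using pos[of v] zero by (cases "v = 0") auto
    then show ?thesis
      unfolding is_arg_min_def using pos[of w] zero by (cases "w = 0") (auto intro: exI[of _ 0])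
  qed
  show "\<not> convex_on UNIV f"
    using assms(1) f by (rule not_convex_on_square_plus_sin_square)
  show "PL_at ((2 + sin2_quot w * \<alpha>)\<^sup>2 / (2 + 2 * \<alpha>)) f w" for w
    using assms(1) f by (intro PL_at_square_plus_sin_square) auto
  show "(2 - 0.46 * \<alpha>)\<^sup>2 / (2 + 2 * \<alpha>) \<le> (2 + sin2_quot w * \<alpha>)\<^sup>2 / (2 + 2 * \<alpha>)" for w
    using avg_ge[of w] lambda_pos assms(1) by (intro divide_right_mono power_mono) auto
  show avg: "avg_hessian f 0 w = (2 + sin2_quot w * \<alpha>) *\<^sub>R id_blinfun" for w
    using f by (rule avg_hessian_square_plus_sin_square)
  show "0 < 2 + sin2_quot w * \<alpha>" for w
    using avg_ge[of w] lambda_pos by linarith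
  show "- 0.46 \<le> sin2_quot w" for w
    by (rule sin2_quot_ge)
  show "average_out (2 - 0.46 * \<alpha>) f 0 w" for w
    unfolding average_out_def avg lambda_min_scaleR_id using avg_ge lambda_pos by simp
qed

end
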